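(* Let $(\mathbf{A},\mathrm{map},\varepsilon,\mu)$ be a category with a map-transformation structure and let $(X,A,B,p,k,q,s)$ be a semi-biproduct in it. Then: (1) the morphism $k$ is a monomorphism; (2) the morphism $p$ is an epimorphism; (3) if $k$ recognizes morphisms then it is the kernel of $p$; (4) if $p$ co-recognizes morphisms then it is the cokernel of $k$.
   Context: Map-transformation structure. Let $\mathbf{A}$ be a pointed category with hom-functor $\hom_{\mathbf A}$ (pointed by zero morphisms). A map-transformation structure on $\mathbf{A}$ consists of: a bifunctor $\mathrm{map}\colon \mathbf{A}^{\mathrm{op}}\times\mathbf{A}\to\mathbf{Set}_*$ into pointed sets which factors through the forgetful functor $\mathbf{Mon}\to\mathbf{Set}_*$ from the category of monoids (so each $\mathrm{map}(A,B)$ is a monoid, written additively with neutral element $0$, and each $\mathrm{map}(f,g)$ is a monoid homomorphism); a natural inclusion (injective natural transformation) of pointed sets $\varepsilon\colon\hom_{\mathbf A}\to\mathrm{map}$ (so $\varepsilon(0)=0$); and, for all objects $A,B,C$, an associative composition $\mu=\mu_{A,B,C}\colon\mathrm{map}(B,C)\times\mathrm{map}(A,B)\to\mathrm{map}(A,C)$. For $x\in\mathrm{map}(A,B)$, $f\colon A'\to A$, $g\colon B\to B'$ write $gxf=\mathrm{map}(f,g)(x)\in\mathrm{map}(A',B')$, and $gx$, $xf$ when $f$, respectively $g$, is an identity. It is required that $\mu(x,\varepsilon(f))=xf$ and $\mu(\varepsilon(g),x)=gx$. Explicitly the conditions say: $g0f=0$, $g(x+y)f=gxf+gyf$, $1x1=x$,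 $g'(gxf)f'=(g'g)x(ff')$, $\varepsilon(0)=0$, $g\varepsilon(u)f=\varepsilon(guf)$, $\mu(x,\varepsilon(f))=xf$, $\mu(\varepsilon(g),x)=gx$, $\mu(x,\mu(x',x''))=\mu(\mu(x,x'),x'')$. Elements of $\mathrm{map}(A,B)$ are called map-transformations from $A$ to $B$. Semi-biproduct. A semi-biproduct $(X,A,B,p,k,q,s)$ in $(\mathbf{A},\mathrm{map},\varepsilon,\mu)$ consists of objects $X,A,B$, morphisms $k\colon X\to A$, $p\colon A\to B$, and map-transformations $q\in\mathrm{map}(A,X)$, $s\in\mathrm{map}(B,A)$ such that $$ps=\varepsilon(1_B),\quad qk=\varepsilon(1_X),\quad kq+sp=\varepsilon(1_A),\quad pk=0_{X,B},\quad \mu(q,s)=\varepsilon(0_{B,X}),$$ where the sum is taken in the monoid $\mathrm{map}(A,A)$. Recognizers. A monomorphism $k\colon X\to A$ recognizes morphisms (is a recognizer) if for every object $Y$ and every $u\in\mathrm{map}(Y,X)$, if there is a morphism $f\colon Y\to A$ with $ku=\varepsilon(f)$, then $u=\varepsilon(u')$ for some morphism $u'\colon Y\to X$. Dually, an epimorphism $p\colon A\to B$ co-recognizes morphisms if for every object $Y$ and every $v\in\mathrm{map}(B,Y)$, if there is a morphism $f\colon A\to Y$ with $vp=\varepsilon(f)$, then $v=\varepsilon(v')$ for some morphism $v'\colon B\to Y$. *)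

theory Defs
  imports "HOL-Algebra.Group"
begin

record ('o, 'm) category =
  Obj :: "'o set"
  Arr :: "'m set"
  Dom :: "'m \<Rightarrow> 'o"
  Cod :: "'m \<Rightarrow> 'o"
  Ide :: "'o \<Rightarrow> 'm"
  Comp :: "'m \<Rightarrow> 'm \<Rightarrow> 'm"  (infixl "\<cdot>\<index>" 70)

text \<open>\<open>g \<cdot> f\<close> is the composite \<open>f\<close> followed by \<open>g\<close>; it is only meaningful for \<open>Cod f = Dom g\<close>.\<close>

definition Hom :: "('o, 'm) category \<Rightarrow> 'o \<Rightarrow> 'o \<Rightarrow> 'm set" where
  "Hom C A B = {f \<in> Arr C. Dom C f = A \<and> Cod C f = B}"

locale category =
  fixes C :: "('o, 'm) category" (structure)
  assumes Dom_in_Obj: "f \<in> Arr C \<Longrightarrow> Dom C f \<in> Obj C"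
    and Cod_in_Obj: "f \<in> Arr C \<Longrightarrow> Cod C f \<in> Obj C"
    and Ide_in_Hom: "A \<in> Obj C \<Longrightarrow> Ide C A \<in> Hom C A A"
    and Comp_in_Hom: "\<lbrakk>f \<in> Hom C A B; g \<in> Hom C B D\<rbrakk> \<Longrightarrow> g \<cdot> f \<in> Hom C A D"
    and Comp_Ide_right: "f \<in> Hom C A B \<Longrightarrow> f \<cdot> Ide C A = f"
    and Comp_Ide_left: "f \<in> Hom C A B \<Longrightarrow> Ide C B \<cdot> f = f"
    and Comp_assoc: "\<lbrakk>f \<in> Hom C A B; g \<in> Hom C B D; h \<in> Hom C D E\<rbrakk>
      \<Longrightarrow> h \<cdot> (g \<cdot> f) = (h \<cdot> g) \<cdot> f"

definition monomorphism :: "('o, 'm) category \<Rightarrow> 'm \<Rightarrow> bool" where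
  "monomorphism C k \<longleftrightarrow> k \<in> Arr C \<and>
     (\<forall>Y \<in> Obj C. \<forall>f \<in> Hom C Y (Dom C k). \<forall>g \<in> Hom C Y (Dom C k).
        k \<cdot>\<^bsub>C\<^esub> f = k \<cdot>\<^bsub>C\<^esub> g \<longrightarrow> f = g)"

definition epimorphism :: "('o, 'm) category \<Rightarrow> 'm \<Rightarrow> bool" where
  "epimorphism C p \<longleftrightarrow> p \<in> Arr C \<and>
     (\<forall>Y \<in> Obj C. \<forall>f \<in> Hom C (Cod C p) Y. \<forall>g \<in> Hom C (Cod C p) Y.
        f \<cdot>\<^bsub>C\<^esub> p = g \<cdot>\<^bsub>C\<^esub> p \<longrightarrow> f = g)"

definition zero_object :: "('o, 'm) category \<Rightarrow> 'o \<Rightarrow> bool" where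
  "zero_object C Z \<longleftrightarrow> Z \<in> Obj C \<and>
     (\<forall>A \<in> Obj C. (\<exists>!f. f \<in> Hom C A Z) \<and> (\<exists>!f. f \<in> Hom C Z A))"

locale pointed_category = category +
  assumes zero_object_exists: "\<exists>Z. zero_object C Z"

definition zero_mor :: "('o, 'm) category \<Rightarrow> 'o \<Rightarrow> 'o \<Rightarrow> 'm" where
  "zero_mor C A B = (THE f. \<exists>Z g h. zero_object C Z \<and> g \<in> Hom C A Z \<and> h \<in> Hom C Z B \<and>
     f = h \<cdot>\<^bsub>C\<^esub> g)"

definition is_kernel :: "('o, 'm) category \<Rightarrow> 'm \<Rightarrow> 'm \<Rightarrow> bool" where
  "is_kernel C k p \<longleftrightarrow> k \<in> Arr C \<and> p \<in> Arr C \<and> Cod C k = Dom C p \<and>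
     p \<cdot>\<^bsub>C\<^esub> k = zero_mor C (Dom C k) (Cod C p) \<and>
     (\<forall>Y \<in> Obj C. \<forall>f \<in> Hom C Y (Dom C p). p \<cdot>\<^bsub>C\<^esub> f = zero_mor C Y (Cod C p) \<longrightarrow>
        (\<exists>!f'. f' \<in> Hom C Y (Dom C k) \<and> k \<cdot>\<^bsub>C\<^esub> f' = f))"

definition is_cokernel :: "('o, 'm) category \<Rightarrow> 'm \<Rightarrow> 'm \<Rightarrow> bool" where
  "is_cokernel C p k \<longleftrightarrow> k \<in> Arr C \<and> p \<in> Arr C \<and> Cod C k = Dom C p \<and>
     p \<cdot>\<^bsub>C\<^esub> k = zero_mor C (Dom C k) (Cod C p) \<and>
     (\<forall>Y \<in> Obj C. \<forall>f \<in> Hom C (Cod C k) Y. f \<cdot>\<^bsub>C\<^esub> k = zero_mor C (Dom C k) Y \<longrightarrow>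
        (\<exists>!f'. f' \<in> Hom C (Cod C p) Y \<and> f' \<cdot>\<^bsub>C\<^esub> p = f))"

lemma (in pointed_category) zero_mor_eq:
  assumes Z: "zero_object C Z" and g: "g \<in> Hom C A Z" and h: "h \<in> Hom C Z B"
  shows "zero_mor C A B = h \<cdot> g"
  unfolding zero_mor_def
proof (rule the_equality)
  show "\<exists>Z g' h'. zero_object C Z \<and> g' \<in> Hom C A Z \<and> h' \<in> Hom C Z B \<and> h \<cdot> g = h' \<cdot> g'"
    using assms by blast
next
  fix f assume "\<exists>Z g h. zero_object C Z \<and> g \<in> Hom C A Z \<and> h \<in> Hom C Z B \<and> f = h \<cdot> g"
  then obtain Z' g' h' where Z': "zero_object C Z'" and g': "g' \<in> Hom C A Z'"
    and h': "h' \<in> Hom C Z' B" and f: "f = h' \<cdot> g'" by blast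
  obtain i where i: "i \<in> Hom C Z Z'"
    using Z Z' by (auto simp: zero_object_def)
  have A: "A \<in> Obj C" using g Dom_in_Obj by (auto simp: Hom_def)
  have B: "B \<in> Obj C" using h Cod_in_Obj by (auto simp: Hom_def)
  have "i \<cdot> g = g'"
    using Comp_in_Hom[OF g i] g' Z' A by (auto simp: zero_object_def)
  moreover have "h' \<cdot> i = h"
    using Comp_in_Hom[OF i h'] h Z B by (auto simp: zero_object_def)
  ultimately show "f = h \<cdot> g"
    using Comp_assoc[OF g i h'] f by simp
qed

text \<open>
  \<open>Tr M A B\<close> is the monoid \<open>map(A,B)\<close>. The literature writes it additively; here it is a
  HOL-Algebra monoid, so \<open>\<otimes>\<close> is the sum and \<open>\<one>\<close> the neutral element \<open>0\<close> (no commutativity is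
  assumed). For \<open>f \<in> Hom C A' A\<close>, \<open>g \<in> Hom C B B'\<close> and \<open>x\<close> in \<open>map(A,B)\<close>, \<open>act M f g x\<close> is
  \<open>map(f,g)(x) = gxf\<close>. The sets \<open>map(A,B)\<close> need not be disjoint, whence the object indices of
  \<open>mu M A B D\<close>, which takes \<open>map(B,D) \<times> map(A,B)\<close> to \<open>map(A,D)\<close>.
\<close>

record ('o, 'm, 't) map_structure =
  Tr :: "'o \<Rightarrow> 'o \<Rightarrow> 't monoid"
  act :: "'m \<Rightarrow> 'm \<Rightarrow> 't \<Rightarrow> 't"
  eps :: "'m \<Rightarrow> 't"
  mu :: "'o \<Rightarrow> 'o \<Rightarrow> 'o \<Rightarrow> 't \<Rightarrow> 't \<Rightarrow> 't"

locale map_transformation_structure = pointed_category C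
  for C :: "('o, 'm) category" (structure) +
  fixes M :: "('o, 'm, 't) map_structure"
  assumes Tr_monoid: "\<lbrakk>A \<in> Obj C; B \<in> Obj C\<rbrakk> \<Longrightarrow> Group.monoid (Tr M A B)"
    and act_hom: "\<lbrakk>f \<in> Hom C A' A; g \<in> Hom C B B'\<rbrakk>
      \<Longrightarrow> act M f g \<in> hom (Tr M A B) (Tr M A' B')"
    and act_zero: "\<lbrakk>f \<in> Hom C A' A; g \<in> Hom C B B'\<rbrakk>
      \<Longrightarrow> act M f g \<one>\<^bsub>Tr M A B\<^esub> = \<one>\<^bsub>Tr M A' B'\<^esub>"
    and act_Ide: "\<lbrakk>A \<in> Obj C; B \<in> Obj C; x \<in> carrier (Tr M A B)\<rbrakk>
      \<Longrightarrow> act M (Ide C A) (Ide C B) x = x"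
    and act_act: "\<lbrakk>f \<in> Hom C A' A; f' \<in> Hom C A'' A'; g \<in> Hom C B B'; g' \<in> Hom C B' B'';
        x \<in> carrier (Tr M A B)\<rbrakk>
      \<Longrightarrow> act M f' g' (act M f g x) = act M (f \<cdot> f') (g' \<cdot> g) x"
    and eps_closed: "u \<in> Hom C A B \<Longrightarrow> eps M u \<in> carrier (Tr M A B)"
    and eps_inj: "\<lbrakk>A \<in> Obj C; B \<in> Obj C\<rbrakk> \<Longrightarrow> inj_on (eps M) (Hom C A B)"
    and eps_zero: "\<lbrakk>A \<in> Obj C; B \<in> Obj C\<rbrakk> \<Longrightarrow> eps M (zero_mor C A B) = \<one>\<^bsub>Tr M A B\<^esub>"
    and eps_natural: "\<lbrakk>f \<in> Hom C A' A; u \<in> Hom C A B; g \<in> Hom C B B'\<rbrakk>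
      \<Longrightarrow> act M f g (eps M u) = eps M (g \<cdot> u \<cdot> f)"
    and mu_closed: "\<lbrakk>A \<in> Obj C; B \<in> Obj C; D \<in> Obj C;
        x \<in> carrier (Tr M B D); y \<in> carrier (Tr M A B)\<rbrakk>
      \<Longrightarrow> mu M A B D x y \<in> carrier (Tr M A D)"
    and mu_eps_right: "\<lbrakk>f \<in> Hom C A B; D \<in> Obj C; x \<in> carrier (Tr M B D)\<rbrakk>
      \<Longrightarrow> mu M A B D x (eps M f) = act M f (Ide C D) x"
    and mu_eps_left: "\<lbrakk>A \<in> Obj C; g \<in> Hom C B D; x \<in> carrier (Tr M A B)\<rbrakk>
      \<Longrightarrow> mu M A B D (eps M g) x = act M (Ide C A) g x"
    and mu_assoc: "\<lbrakk>A \<in> Obj C; B \<in> Obj C; D \<in> Obj C; E \<in> Obj C;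
        x \<in> carrier (Tr M D E); x' \<in> carrier (Tr M B D); x'' \<in> carrier (Tr M A B)\<rbrakk>
      \<Longrightarrow> mu M A D E x (mu M A B D x' x'') = mu M A B E (mu M B D E x x') x''"

definition semi_biproduct ::
  "('o, 'm) category \<Rightarrow> ('o, 'm, 't) map_structure \<Rightarrow>
   'o \<Rightarrow> 'o \<Rightarrow> 'o \<Rightarrow> 'm \<Rightarrow> 'm \<Rightarrow> 't \<Rightarrow> 't \<Rightarrow> bool" where
  "semi_biproduct C M X A B p k q s \<longleftrightarrow>
     X \<in> Obj C \<and> A \<in> Obj C \<and> B \<in> Obj C \<and>
     k \<in> Hom C X A \<and> p \<in> Hom C A B \<and>
     q \<in> carrier (Tr M A X) \<and> s \<in> carrier (Tr M B A) \<and>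
     act M (Ide C B) p s = eps M (Ide C B) \<and>
     act M k (Ide C X) q = eps M (Ide C X) \<and>
     act M (Ide C A) k q \<otimes>\<^bsub>Tr M A A\<^esub> act M p (Ide C A) s = eps M (Ide C A) \<and>
     p \<cdot>\<^bsub>C\<^esub> k = zero_mor C X B \<and>
     mu M B A X q s = eps M (zero_mor C B X)"

definition recognizes_morphisms ::
  "('o, 'm) category \<Rightarrow> ('o, 'm, 't) map_structure \<Rightarrow> 'm \<Rightarrow> bool" where
  "recognizes_morphisms C M k \<longleftrightarrow> monomorphism C k \<and>
     (\<forall>Y \<in> Obj C. \<forall>u \<in> carrier (Tr M Y (Dom C k)).
        (\<exists>f \<in> Hom C Y (Cod C k). act M (Ide C Y) k u = eps M f) \<longrightarrow>
        (\<exists>u' \<in> Hom C Y (Dom C k). u = eps M u'))"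

definition corecognizes_morphisms ::
  "('o, 'm) category \<Rightarrow> ('o, 'm, 't) map_structure \<Rightarrow> 'm \<Rightarrow> bool" where
  "corecognizes_morphisms C M p \<longleftrightarrow> epimorphism C p \<and>
     (\<forall>Y \<in> Obj C. \<forall>v \<in> carrier (Tr M (Cod C p) Y).
        (\<exists>f \<in> Hom C (Dom C p) Y. act M p (Ide C Y) v = eps M f) \<longrightarrow>
        (\<exists>v' \<in> Hom C (Cod C p) Y. v = eps M v'))"

end

theory Submission
  imports Defs
begin

text \<open>
  The relations \<open>qk = 1\<close> and \<open>ps = 1\<close> make \<open>k\<close> split mono and \<open>p\<close> split epi at the level of
  map-transformations, which suffices because \<open>\<epsilon>\<close> is injective. If \<open>pf = 0\<close>, then composing
  \<open>kq + sp = 1\<close> with \<open>f\<close> gives \<open>f = k(qf) + s0\<close>, so \<open>qf\<close> is the required factorization once it is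
  recognized as a morphism; dually, \<open>fk = 0\<close> gives \<open>f = 0q + (fs)p\<close>. That \<open>s0 = 0\<close> and \<open>0q = 0\<close> is
  not part of the structure, since \<open>map(Z,A)\<close> may be nontrivial for a zero object \<open>Z\<close>. It follows by
  composing \<open>kq + sp = 1\<close> with a zero morphism: \<open>q0 = qk0 = 0\<close> forces \<open>s0 = sp0 = 0\<close>, and
  \<open>0s = 0ps = 0\<close> forces \<open>0q = 0kq = 0\<close>.
\<close>

section \<open>Categories and zero morphisms\<close>

context category
begin

lemma Hom_Obj:
  assumes "f \<in> Hom C A B"
  shows "A \<in> Obj C" "B \<in> Obj C"
  using assms Dom_in_Obj Cod_in_Obj by (auto simp: Hom_def)

lemma Hom_Arr: "f \<in> Hom C A B \<Longrightarrow> f \<in> Arr C"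
  and Hom_Dom: "f \<in> Hom C A B \<Longrightarrow> Dom C f = A"
  and Hom_Cod: "f \<in> Hom C A B \<Longrightarrow> Cod C f = B"
  by (auto simp: Hom_def)

end

context pointed_category
begin

text \<open>Replaces the definite description behind \<open>zero_mor\<close> by an explicit path
  through a zero object, from which the absorption laws follow by associativity.\<close>

lemma zero_mor_factors:
  assumes "A \<in> Obj C" "B \<in> Obj C"
  obtains Z g h where "zero_object C Z" "g \<in> Hom C A Z" "h \<in> Hom C Z B"
    "zero_mor C A B = h \<cdot> g"
proof -
  obtain Z where Z: "zero_object C Z" using zero_object_exists by blast
  obtain g where g: "g \<in> Hom C A Z" using Z assms by (auto simp: zero_object_def)
  obtain h where h: "h \<in> Hom C Z B" using Z assms by (auto simp: zero_object_def)
  show thesis using that[OF Z g h zero_mor_eq[OF Z g h]] .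
qed

lemma zero_mor_in_Hom:
  assumes "A \<in> Obj C" "B \<in> Obj C"
  shows "zero_mor C A B \<in> Hom C A B"
  using zero_mor_factors[OF assms] Comp_in_Hom by metis

lemma Comp_zero_mor_right:
  assumes A: "A \<in> Obj C" and f: "f \<in> Hom C B D"
  shows "f \<cdot> zero_mor C A B = zero_mor C A D"
proof -
  obtain Z g h where Z: "zero_object C Z" and g: "g \<in> Hom C A Z" and h: "h \<in> Hom C Z B"
    and eq: "zero_mor C A B = h \<cdot> g"
    using zero_mor_factors[OF A Hom_Obj(1)[OF f]] .
  show ?thesis
    using Comp_assoc[OF g h f] zero_mor_eq[OF Z g Comp_in_Hom[OF h f]] by (simp add: eq)
qed

lemma Comp_zero_mor_left:
  assumes f: "f \<in> Hom C A B" and D: "D \<in> Obj C"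
  shows "zero_mor C B D \<cdot> f = zero_mor C A D"
proof -
  obtain Z g h where Z: "zero_object C Z" and g: "g \<in> Hom C B Z" and h: "h \<in> Hom C Z D"
    and eq: "zero_mor C B D = h \<cdot> g"
    using zero_mor_factors[OF Hom_Obj(2)[OF f] D] .
  show ?thesis
    using Comp_assoc[OF f g h] zero_mor_eq[OF Z Comp_in_Hom[OF f g] h] by (simp add: eq)
qed

end

section \<open>Calculus of one-sided actions on map-transformations\<close>

context map_transformation_structure
begin

lemma act_closed:
  "\<lbrakk>f \<in> Hom C A' A; g \<in> Hom C B B'; x \<in> carrier (Tr M A B)\<rbrakk>
    \<Longrightarrow> act M f g x \<in> carrier (Tr M A' B')"
  using act_hom hom_in_carrier by metis

text \<open>With \<open>act_right_left\<close>, this reduces both g(xf) and (gx)f to the two-sided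
  action gxf, so the two bracketings can be exchanged.\<close>

lemma act_left_right:
  assumes "f \<in> Hom C A' A" "g \<in> Hom C B B'" "x \<in> carrier (Tr M A B)"
  shows "act M (Ide C A') g (act M f (Ide C B) x) = act M f g x"
  using act_act[OF assms(1) Ide_in_Hom Ide_in_Hom assms(2,3)] assms Hom_Obj
  by (metis Comp_Ide_left Comp_Ide_right)

lemma act_right_left:
  assumes "f \<in> Hom C A' A" "g \<in> Hom C B B'" "x \<in> carrier (Tr M A B)"
  shows "act M f (Ide C B') (act M (Ide C A) g x) = act M f g x"
  using act_act[OF Ide_in_Hom assms(1) assms(2) Ide_in_Hom assms(3)] assms Hom_Obj
  by (metis Comp_Ide_left Comp_Ide_right)

lemma act_right_right:
  assumes "f \<in> Hom C A' A" "f' \<in> Hom C A'' A'" "B \<in> Obj C" "x \<in> carrier (Tr M A B)"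
  shows "act M f' (Ide C B) (act M f (Ide C B) x) = act M (f \<cdot> f') (Ide C B) x"
  using act_act[OF assms(1,2) Ide_in_Hom Ide_in_Hom assms(4)] assms(3)
  by (metis Comp_Ide_left Ide_in_Hom)

lemma act_left_left:
  assumes "g \<in> Hom C B B'" "g' \<in> Hom C B' B''" "A \<in> Obj C" "x \<in> carrier (Tr M A B)"
  shows "act M (Ide C A) g' (act M (Ide C A) g x) = act M (Ide C A) (g' \<cdot> g) x"
  using act_act[OF Ide_in_Hom Ide_in_Hom assms(1,2,4)] assms(3)
  by (metis Comp_Ide_left Ide_in_Hom)

text \<open>Naturality of \<open>eps\<close> at an identity. Acting with f on an equation whose
  right side is \<open>eps\<close> of an identity thus yields an equation for
  \<open>eps M f\<close>.\<close>

lemma act_right_eps_Ide: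
  assumes "f \<in> Hom C A B"
  shows "act M f (Ide C B) (eps M (Ide C B)) = eps M f"
  using eps_natural[OF assms Ide_in_Hom Ide_in_Hom] Hom_Obj[OF assms] assms
  by (metis Comp_Ide_left Ide_in_Hom)

lemma act_left_eps_Ide:
  assumes "f \<in> Hom C A B"
  shows "act M (Ide C A) f (eps M (Ide C A)) = eps M f"
  using eps_natural[OF Ide_in_Hom Ide_in_Hom assms] Hom_Obj[OF assms] assms
  by (metis Comp_Ide_right)

lemma eps_eqD:
  assumes "f \<in> Hom C A B" "g \<in> Hom C A B" "eps M f = eps M g"
  shows "f = g"
  using eps_inj[OF Hom_Obj[OF assms(1)]] assms by (auto dest: inj_onD)

end

section \<open>Semi-biproducts: decomposition of morphisms and zero laws\<close>

locale semi_biproduct_in = map_transformation_structure C M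
  for C :: "('o, 'm) category" (structure) and M :: "('o, 'm, 't) map_structure" +
  fixes X A B :: 'o and p k :: 'm and q s :: 't
  assumes semi_biproduct: "semi_biproduct C M X A B p k q s"
begin

lemma objects: "X \<in> Obj C" "A \<in> Obj C" "B \<in> Obj C"
  and k_in_Hom: "k \<in> Hom C X A"
  and p_in_Hom: "p \<in> Hom C A B"
  and q_closed: "q \<in> carrier (Tr M A X)"
  and s_closed: "s \<in> carrier (Tr M B A)"
  and p_s: "act M (Ide C B) p s = eps M (Ide C B)"
  and q_k: "act M k (Ide C X) q = eps M (Ide C X)"
  and kq_sp: "act M (Ide C A) k q \<otimes>\<^bsub>Tr M A A\<^esub> act M p (Ide C A) s = eps M (Ide C A)"
  and p_k: "p \<cdot> k = zero_mor C X B"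
  using semi_biproduct by (auto simp: semi_biproduct_def)

text \<open>q(kf) = (qk)f = 1f, so q recovers f from kf; this is what makes k left
  cancellable.\<close>

lemma q_act_k:
  assumes f: "f \<in> Hom C Y X"
  shows "act M (k \<cdot> f) (Ide C X) q = eps M f"
  using act_right_right[OF k_in_Hom f objects(1) q_closed] act_right_eps_Ide[OF f]
  by (simp add: q_k)

lemma p_act_s:
  assumes f: "f \<in> Hom C B Y"
  shows "act M (Ide C B) (f \<cdot> p) s = eps M f"
  using act_left_left[OF p_in_Hom f objects(3) s_closed] act_left_eps_Ide[OF f]
  by (simp add: p_s)

text \<open>Precompose kq + sp = 1 with f; the action is a monoid homomorphism, so it distributes
  over the sum.\<close>

lemma eps_decomp_right:
  assumes f: "f \<in> Hom C Y A"
  shows "eps M f = act M (Ide C Y) k (act M f (Ide C X) q) \<otimes>\<^bsub>Tr M Y A\<^esub> act M (p \<cdot> f) (Ide C A) s"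
proof -
  have "eps M f = act M f (Ide C A) (act M (Ide C A) k q \<otimes>\<^bsub>Tr M A A\<^esub> act M p (Ide C A) s)"
    using act_right_eps_Ide[OF f] by (simp add: kq_sp)
  also have "\<dots> = act M f (Ide C A) (act M (Ide C A) k q) \<otimes>\<^bsub>Tr M Y A\<^esub>
      act M f (Ide C A) (act M p (Ide C A) s)"
    using act_hom[OF f Ide_in_Hom[OF objects(2)]]
      act_closed[OF Ide_in_Hom[OF objects(2)] k_in_Hom q_closed]
      act_closed[OF p_in_Hom Ide_in_Hom[OF objects(2)] s_closed]
    by (rule hom_mult)
  \<comment> \<open>Both (kq)f and k(qf) are rewritten to kqf, and (sp)f becomes s(pf).\<close>
  finally show ?thesis
    by (simp add: act_left_right[OF f k_in_Hom q_closed] act_right_left[OF f k_in_Hom q_closed]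
        act_right_right[OF p_in_Hom f objects(2) s_closed])
qed

lemma eps_decomp_left:
  assumes f: "f \<in> Hom C A Y"
  shows "eps M f = act M (Ide C A) (f \<cdot> k) q \<otimes>\<^bsub>Tr M A Y\<^esub> act M p (Ide C Y) (act M (Ide C B) f s)"
proof -
  have "eps M f = act M (Ide C A) f (act M (Ide C A) k q \<otimes>\<^bsub>Tr M A A\<^esub> act M p (Ide C A) s)"
    using act_left_eps_Ide[OF f] by (simp add: kq_sp)
  also have "\<dots> = act M (Ide C A) f (act M (Ide C A) k q) \<otimes>\<^bsub>Tr M A Y\<^esub>
      act M (Ide C A) f (act M p (Ide C A) s)"
    using act_hom[OF Ide_in_Hom[OF objects(2)] f]
      act_closed[OF Ide_in_Hom[OF objects(2)] k_in_Hom q_closed]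
      act_closed[OF p_in_Hom Ide_in_Hom[OF objects(2)] s_closed]
    by (rule hom_mult)
  finally show ?thesis
    by (simp add: act_left_right[OF p_in_Hom f s_closed] act_right_left[OF p_in_Hom f s_closed]
        act_left_left[OF k_in_Hom f objects(2) q_closed])
qed

lemma s_zero:
  assumes Y: "Y \<in> Obj C"
  shows "act M (zero_mor C Y B) (Ide C A) s = \<one>\<^bsub>Tr M Y A\<^esub>"
proof -
  interpret T: monoid "Tr M Y A" using Tr_monoid[OF Y objects(2)] .
  have zB: "zero_mor C Y B \<in> Hom C Y B" and zA: "zero_mor C Y A \<in> Hom C Y A"
    and zX: "zero_mor C Y X \<in> Hom C Y X"
    using zero_mor_in_Hom Y objects by auto
  \<comment> \<open>The zero morphism Y to A is k0, so q0 = q(k0) = \<open>eps\<close> of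
    zero.\<close>
  have "act M (zero_mor C Y A) (Ide C X) q = \<one>\<^bsub>Tr M Y X\<^esub>"
    using q_act_k[OF zX]
    by (simp add: Comp_zero_mor_right[OF Y k_in_Hom] eps_zero[OF Y objects(1)])
  \<comment> \<open>Decomposing the zero morphism gives 0 = k0 + s0 with k0 = 0. The unit law then
    isolates s0, without any cancellation in the monoid.\<close>
  then have "\<one>\<^bsub>Tr M Y A\<^esub> = \<one>\<^bsub>Tr M Y A\<^esub> \<otimes>\<^bsub>Tr M Y A\<^esub> act M (zero_mor C Y B) (Ide C A) s"
    using eps_decomp_right[OF zA]
    by (simp add: Comp_zero_mor_right[OF Y p_in_Hom] eps_zero[OF Y objects(2)]
        act_zero[OF Ide_in_Hom[OF Y] k_in_Hom])
  then show ?thesis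
    using act_closed[OF zB Ide_in_Hom[OF objects(2)] s_closed] by simp
qed

lemma zero_q:
  assumes Y: "Y \<in> Obj C"
  shows "act M (Ide C A) (zero_mor C X Y) q = \<one>\<^bsub>Tr M A Y\<^esub>"
proof -
  interpret T: monoid "Tr M A Y" using Tr_monoid[OF objects(2) Y] .
  have zB: "zero_mor C B Y \<in> Hom C B Y" and zA: "zero_mor C A Y \<in> Hom C A Y"
    and zX: "zero_mor C X Y \<in> Hom C X Y"
    using zero_mor_in_Hom Y objects by auto
  \<comment> \<open>Dually, the zero morphism A to Y is 0p, so 0s = (0p)s = \<open>eps\<close> of
    zero.\<close>
  have "act M (Ide C B) (zero_mor C A Y) s = \<one>\<^bsub>Tr M B Y\<^esub>"
    using p_act_s[OF zB]
    by (simp add: Comp_zero_mor_left[OF p_in_Hom Y] eps_zero[OF objects(3) Y])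
  then have "\<one>\<^bsub>Tr M A Y\<^esub> = act M (Ide C A) (zero_mor C X Y) q \<otimes>\<^bsub>Tr M A Y\<^esub> \<one>\<^bsub>Tr M A Y\<^esub>"
    using eps_decomp_left[OF zA]
    by (simp add: Comp_zero_mor_left[OF k_in_Hom Y] eps_zero[OF objects(2) Y]
        act_zero[OF p_in_Hom Ide_in_Hom[OF Y]])
  then show ?thesis
    using act_closed[OF Ide_in_Hom[OF objects(2)] zX q_closed] by simp
qed

section \<open>Cancellation and the universal properties\<close>

lemma k_cancel:
  assumes "f \<in> Hom C Y X" "g \<in> Hom C Y X" "k \<cdot> f = k \<cdot> g"
  shows "f = g"
  using q_act_k[OF assms(1)] q_act_k[OF assms(2)] assms by (auto intro: eps_eqD)

lemma p_cancel:
  assumes "f \<in> Hom C B Y" "g \<in> Hom C B Y" "f \<cdot> p = g \<cdot> p"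
  shows "f = g"
  using p_act_s[OF assms(1)] p_act_s[OF assms(2)] assms by (auto intro: eps_eqD)

lemma monomorphism_k: "monomorphism C k"
  unfolding monomorphism_def
  using k_cancel Hom_Arr[OF k_in_Hom] Hom_Dom[OF k_in_Hom] by auto

lemma epimorphism_p: "epimorphism C p"
  unfolding epimorphism_def
  using p_cancel Hom_Arr[OF p_in_Hom] Hom_Cod[OF p_in_Hom] by auto

lemma kernel_factorization:
  assumes rec: "recognizes_morphisms C M k"
    and f: "f \<in> Hom C Y A" and pf: "p \<cdot> f = zero_mor C Y B"
  shows "\<exists>f'. f' \<in> Hom C Y X \<and> k \<cdot> f' = f"
proof -
  have Y: "Y \<in> Obj C" using Hom_Obj[OF f] by simp
  interpret T: monoid "Tr M Y A" using Tr_monoid[OF Y objects(2)] .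
  let ?u = "act M f (Ide C X) q"
  have u: "?u \<in> carrier (Tr M Y X)"
    using act_closed[OF f Ide_in_Hom[OF objects(1)] q_closed] .
  \<comment> \<open>The summand s(pf) is s0 = 0, which leaves f = k(qf).\<close>
  have ku: "act M (Ide C Y) k ?u = eps M f"
    using eps_decomp_right[OF f] act_closed[OF Ide_in_Hom[OF Y] k_in_Hom u]
    by (simp add: pf s_zero[OF Y])
  obtain f' where f': "f' \<in> Hom C Y X" and uf': "?u = eps M f'"
    using rec u ku f Y
    unfolding recognizes_morphisms_def Hom_Dom[OF k_in_Hom] Hom_Cod[OF k_in_Hom] by blast
  \<comment> \<open>Naturality turns k acting on \<open>eps M f'\<close> into \<open>eps\<close> of
    a composite; injectivity of \<open>eps\<close> then brings the equation back to
    morphisms.\<close>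
  have "eps M (k \<cdot> f') = eps M f"
    using eps_natural[OF Ide_in_Hom[OF Y] f' k_in_Hom] ku Comp_in_Hom[OF f' k_in_Hom]
    by (simp add: uf' Comp_Ide_right)
  then show ?thesis
    using eps_eqD[OF Comp_in_Hom[OF f' k_in_Hom] f] f' by blast
qed

lemma cokernel_factorization:
  assumes corec: "corecognizes_morphisms C M p"
    and f: "f \<in> Hom C A Y" and fk: "f \<cdot> k = zero_mor C X Y"
  shows "\<exists>f'. f' \<in> Hom C B Y \<and> f' \<cdot> p = f"
proof -
  have Y: "Y \<in> Obj C" using Hom_Obj[OF f] by simp
  interpret T: monoid "Tr M A Y" using Tr_monoid[OF objects(2) Y] .
  let ?v = "act M (Ide C B) f s"
  have v: "?v \<in> carrier (Tr M B Y)"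
    using act_closed[OF Ide_in_Hom[OF objects(3)] f s_closed] .
  \<comment> \<open>Here the other summand vanishes: (fk)q = 0q = 0, so f = (fs)p.\<close>
  have vp: "act M p (Ide C Y) ?v = eps M f"
    using eps_decomp_left[OF f] act_closed[OF p_in_Hom Ide_in_Hom[OF Y] v]
    by (simp add: fk zero_q[OF Y])
  obtain f' where f': "f' \<in> Hom C B Y" and vf': "?v = eps M f'"
    using corec v vp f Y
    unfolding corecognizes_morphisms_def Hom_Dom[OF p_in_Hom] Hom_Cod[OF p_in_Hom] by blast
  have "eps M (f' \<cdot> p) = eps M f"
    using eps_natural[OF p_in_Hom f' Ide_in_Hom[OF Y]] vp
    by (simp add: vf' Comp_Ide_left[OF f'])
  then show ?thesis
    using eps_eqD[OF Comp_in_Hom[OF p_in_Hom f'] f] f' by blast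
qed

lemma is_kernel_k:
  assumes "recognizes_morphisms C M k"
  shows "is_kernel C k p"
  unfolding is_kernel_def Hom_Dom[OF k_in_Hom] Hom_Cod[OF k_in_Hom]
    Hom_Dom[OF p_in_Hom] Hom_Cod[OF p_in_Hom]
  using Hom_Arr[OF k_in_Hom] Hom_Arr[OF p_in_Hom] p_k
    kernel_factorization[OF assms] k_cancel by blast

lemma is_cokernel_p:
  assumes "corecognizes_morphisms C M p"
  shows "is_cokernel C p k"
  unfolding is_cokernel_def Hom_Dom[OF k_in_Hom] Hom_Cod[OF k_in_Hom]
    Hom_Dom[OF p_in_Hom] Hom_Cod[OF p_in_Hom]
  using Hom_Arr[OF k_in_Hom] Hom_Arr[OF p_in_Hom] p_k
    cokernel_factorization[OF assms] p_cancel by blast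

end

theorem theorem4:
  fixes C :: "('o, 'm) category" and M :: "('o, 'm, 't) map_structure"
    and X A B :: 'o and p k :: 'm and q s :: 't
  assumes "map_transformation_structure C M"
    and "semi_biproduct C M X A B p k q s"
  shows "monomorphism C k \<and>
         epimorphism C p \<and>
         (recognizes_morphisms C M k \<longrightarrow> is_kernel C k p) \<and>
         (corecognizes_morphisms C M p \<longrightarrow> is_cokernel C p k)"
proof -
  interpret semi_biproduct_in C M X A B p k q s
    using assms by (simp add: semi_biproduct_in_def semi_biproduct_in_axioms_def)
  show ?thesis
    using monomorphism_k epimorphism_p is_kernel_k is_cokernel_p by blast
qed

end
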